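(* For $j=1,\dots,p$ let $\widetilde{K}_j=\widetilde{Q}_j\widetilde{\Gamma}_j\widetilde{Q}_j^T$ be an eigendecomposition of the $d_j\times d_j$ marginal penalty matrix $\widetilde{K}_j$ (so $\widetilde{Q}_j$ is orthogonal and $\widetilde{\Gamma}_j$ is diagonal). Let $Q=\widetilde{Q}_1\otimes\dots\otimes\widetilde{Q}_p$ and $$\Gamma_j=I_{d_1}\otimes\dots\otimes I_{d_{j-1}}\otimes\widetilde{\Gamma}_j\otimes I_{d_{j+1}}\otimes\dots\otimes I_{d_p},\qquad j=1,\dots,p.$$ Then, for all $\tau^2=(\tau_1^2,\dots,\tau_p^2)\in(0,\infty)^p$, $$K(\tau^2)=Q\left(\frac{\Gamma_1}{\tau_1^2}+\dots+\frac{\Gamma_p}{\tau_p^2}\right)Q^T.$$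
   Context: Let $p\geq 2$ and let $d_1,\dots,d_p$ be the dimensions of $p$ (cubic) B-spline bases (so $d_j\ge 4$). For each $j$, the marginal penalty matrix is the $d_j\times d_j$ second order differences penalty matrix $\widetilde{K}_j=\Delta_j^T\Delta_j$, where $\Delta_j$ is the $(d_j-2)\times d_j$ second order difference matrix, $(\Delta_j v)_i=v_i-2v_{i+1}+v_{i+2}$. In particular $\widetilde K_j$ is real, symmetric and positive semidefinite. $I_d$ is the $d\times d$ identity matrix and $\otimes$ is the Kronecker product of matrices. For $\tau^2\in(0,\infty)^p$ the overall roughness penalty matrix is the $D\times D$ matrix, $D=\prod_{j=1}^p d_j$, $$K(\tau^2)=\frac{K_1}{\tau_1^2}+\dots+\frac{K_p}{\tau_p^2},\qquad K_j=I_{d_1}\otimes\dots\otimes I_{d_{j-1}}\otimes\widetilde{K}_j\otimes I_{d_{j+1}}\otimes\dots\otimes I_{d_p}.$$ *)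

theory Defs
  imports "Jordan_Normal_Form.Matrix"
begin

definition kron :: "'a :: times mat \<Rightarrow> 'a mat \<Rightarrow> 'a mat" (infixr \<open>\<otimes>\<^sub>m\<close> 72) where
  "A \<otimes>\<^sub>m B = mat (dim_row A * dim_row B) (dim_col A * dim_col B)
     (\<lambda>(i, j). A $$ (i div dim_row B, j div dim_col B) * B $$ (i mod dim_row B, j mod dim_col B))"

text \<open>The \<open>1 \<times> 1\<close> identity matrix is a neutral element of the Kronecker product, so
  \<open>kron_list [A\<^sub>1, \<dots>, A\<^sub>n]\<close> is \<open>A\<^sub>1 \<otimes> \<dots> \<otimes> A\<^sub>n\<close>.\<close>

definition kron_list :: "'a :: semiring_1 mat list \<Rightarrow> 'a mat" where
  "kron_list As = foldr (\<otimes>\<^sub>m) As (1\<^sub>m 1)"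

text \<open>\<open>I \<otimes> \<dots> \<otimes> I \<otimes> M \<otimes> I \<otimes> \<dots> \<otimes> I\<close> with \<open>M\<close> as the \<open>j\<close>-th of \<open>p\<close> factors;
  factors are numbered from 1 and the identity in position \<open>i\<close> has size \<open>d i\<close>.\<close>

definition kron_at :: "nat \<Rightarrow> (nat \<Rightarrow> nat) \<Rightarrow> nat \<Rightarrow> 'a :: semiring_1 mat \<Rightarrow> 'a mat" where
  "kron_at p d j M = kron_list
     (map (\<lambda>i. 1\<^sub>m (d i)) [1..<j] @ [M] @ map (\<lambda>i. 1\<^sub>m (d i)) [Suc j..<Suc p])"

definition diff2_mat :: "nat \<Rightarrow> real mat" where
  "diff2_mat n = mat (n - 2) n
     (\<lambda>(i, k). if k = i then 1 else if k = i + 1 then - 2 else if k = i + 2 then 1 else 0)"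

definition marginal_penalty :: "nat \<Rightarrow> real mat" where
  "marginal_penalty n = transpose_mat (diff2_mat n) * diff2_mat n"

definition total_dim :: "nat \<Rightarrow> (nat \<Rightarrow> nat) \<Rightarrow> nat" where
  "total_dim p d = (\<Prod>j = 1..p. d j)"

text \<open>Matrices of unspecified size are not a monoid under addition, hence the sum is taken in the
  module of \<open>D \<times> D\<close> matrices. The value \<open>t j\<close> stands for \<open>\<tau>\<^sub>j\<^sup>2\<close> itself, not for \<open>\<tau>\<^sub>j\<close>.\<close>

definition weighted_sum :: "nat \<Rightarrow> nat \<Rightarrow> (nat \<Rightarrow> real) \<Rightarrow> (nat \<Rightarrow> real mat) \<Rightarrow> real mat" where
  "weighted_sum D p t M =
     finsum (module_mat TYPE(real) D D) (\<lambda>j. (1 / t j) \<cdot>\<^sub>m M j) {1..p}"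

definition roughness_penalty :: "nat \<Rightarrow> (nat \<Rightarrow> nat) \<Rightarrow> (nat \<Rightarrow> real) \<Rightarrow> real mat" where
  "roughness_penalty p d t =
     weighted_sum (total_dim p d) p t (\<lambda>j. kron_at p d j (marginal_penalty (d j)))"

text \<open>The predicate \<^const>\<open>orthogonal_mat\<close> only asks for pairwise orthogonal nonzero columns; an
  eigendecomposition needs them to be orthonormal.\<close>

definition orthonormal_mat :: "nat \<Rightarrow> real mat \<Rightarrow> bool" where
  "orthonormal_mat n Q \<longleftrightarrow> Q \<in> carrier_mat n n \<and>
     transpose_mat Q * Q = 1\<^sub>m n \<and> Q * transpose_mat Q = 1\<^sub>m n"

definition eigendecomposition :: "nat \<Rightarrow> real mat \<Rightarrow> real mat \<Rightarrow> real mat \<Rightarrow> bool" where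
  "eigendecomposition n A Q G \<longleftrightarrow> orthonormal_mat n Q \<and>
     G \<in> carrier_mat n n \<and> diagonal_mat G \<and> A = Q * G * transpose_mat Q"

end

theory Submission
  imports Defs
begin

text \<open>By the mixed-product property of \<open>\<otimes>\<close>, conjugating \<open>\<Gamma>\<^sub>j\<close> with \<open>Q\<close> conjugates each tensor
  factor with the corresponding \<open>Q\<^sub>i\<close>. Factors \<open>i \<noteq> j\<close> give \<open>Q\<^sub>i Q\<^sub>i\<^sup>T = I\<close>, and the \<open>j\<close>-th
  gives the marginal penalty, so \<open>Q \<Gamma>\<^sub>j Q\<^sup>T = K\<^sub>j\<close>; the claim follows by linearity of conjugation.\<close>

text \<open>Cutting the range into \<open>n\<close> blocks of length \<open>m\<close> amounts to
  division with remainder by \<open>m\<close>. This is how an index of a Kronecker product splits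
  into a pair of indices.\<close>

lemma sum_lessThan_mult:
  fixes f :: "nat \<Rightarrow> 'a :: comm_monoid_add"
  shows "sum f {..<n * m} = (\<Sum>x<n. \<Sum>y<m. f (x * m + y))"
proof -
  have "sum f {x * m..<x * m + m} = (\<Sum>y<m. f (x * m + y))" for x
    using sum.shift_bounds_nat_ivl[of f 0 "x * m" m]
    by (simp add: add.commute lessThan_atLeast0)
  then show ?thesis
    by (simp flip: sum.nat_group)
qed

lemma div_less_of_less_mult: "i < a * b \<Longrightarrow> i div b < a" for i a b :: nat
  by (simp add: less_mult_imp_div_less)

lemma mod_less_of_less_mult: "i < a * b \<Longrightarrow> i mod b < b" for i a b :: nat
  by (cases "b = 0") auto

lemma kron_carrier_mat [intro]:
  assumes "A \<in> carrier_mat a b" "B \<in> carrier_mat a' b'"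
  shows "A \<otimes>\<^sub>m B \<in> carrier_mat (a * a') (b * b')"
  using assms by (auto simp: kron_def)

lemma index_kron:
  assumes "A \<in> carrier_mat a b" "B \<in> carrier_mat a' b'" "i < a * a'" "j < b * b'"
  shows "(A \<otimes>\<^sub>m B) $$ (i, j) = A $$ (i div a', j div b') * B $$ (i mod a', j mod b')"
  using assms by (auto simp: kron_def)

text \<open>The mixed-product property: the summation index of size \<open>n * m\<close> splits as
  \<open>x * m + y\<close>, each summand becomes a term in \<open>x\<close> times a term in
  \<open>y\<close>, and the double sum factors.\<close>

lemma kron_mult:
  fixes A B C D :: "'a :: comm_semiring_0 mat"
  assumes A: "A \<in> carrier_mat a n" and C: "C \<in> carrier_mat n c"
    and B: "B \<in> carrier_mat b m" and D: "D \<in> carrier_mat m e"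
  shows "(A \<otimes>\<^sub>m B) * (C \<otimes>\<^sub>m D) = (A * C) \<otimes>\<^sub>m (B * D)"
proof (rule eq_matI)
  note AB = kron_carrier_mat[OF A B] and CD = kron_carrier_mat[OF C D]
  note AC = mult_carrier_mat[OF A C] and BD = mult_carrier_mat[OF B D]
  show "dim_row ((A \<otimes>\<^sub>m B) * (C \<otimes>\<^sub>m D)) = dim_row ((A * C) \<otimes>\<^sub>m (B * D))"
    "dim_col ((A \<otimes>\<^sub>m B) * (C \<otimes>\<^sub>m D)) = dim_col ((A * C) \<otimes>\<^sub>m (B * D))"
    by (simp_all add: kron_def)
  fix i j
  assume "i < dim_row ((A * C) \<otimes>\<^sub>m (B * D))" "j < dim_col ((A * C) \<otimes>\<^sub>m (B * D))"
  then have i: "i < a * b" and j: "j < c * e"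
    using kron_carrier_mat[OF AC BD] by auto
  note ij = div_less_of_less_mult[OF i] mod_less_of_less_mult[OF i]
    div_less_of_less_mult[OF j] mod_less_of_less_mult[OF j]
  \<comment> \<open>\<open>index_kron\<close> speaks only about indices in range, so the recombined
    index has to be bounded.\<close>
  have bound: "x * m + y < n * m" if "x < n" "y < m" for x y
  proof -
    have "x * m + y < Suc x * m"
      using that by simp
    also have "\<dots> \<le> n * m"
      using that by (intro mult_le_mono1) simp
    finally show ?thesis .
  qed
  have "((A \<otimes>\<^sub>m B) * (C \<otimes>\<^sub>m D)) $$ (i, j) =
      (\<Sum>k<n * m. (A \<otimes>\<^sub>m B) $$ (i, k) * (C \<otimes>\<^sub>m D) $$ (k, j))"
    using AB CD i j by (auto simp: scalar_prod_def lessThan_atLeast0)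
  also have "\<dots> = (\<Sum>x<n. \<Sum>y<m. (A \<otimes>\<^sub>m B) $$ (i, x * m + y) * (C \<otimes>\<^sub>m D) $$ (x * m + y, j))"
    by (rule sum_lessThan_mult)
  also have "\<dots> = (\<Sum>x<n. \<Sum>y<m. (A $$ (i div b, x) * C $$ (x, j div e)) *
      (B $$ (i mod b, y) * D $$ (y, j mod e)))"
    \<comment> \<open>Since \<open>y < m\<close>, dividing \<open>x * m + y\<close> by
      \<open>m\<close> gives quotient \<open>x\<close> and remainder \<open>y\<close>; commutativity
      then regroups the four entries.\<close>
    by (intro sum.cong refl)
      (simp add: index_kron[OF A B i] index_kron[OF C D _ j] bound mult.assoc mult.left_commute)
  also have "\<dots> = (\<Sum>x<n. A $$ (i div b, x) * C $$ (x, j div e)) *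
      (\<Sum>y<m. B $$ (i mod b, y) * D $$ (y, j mod e))"
    by (simp add: sum_product)
  also have "\<dots> = (A * C) $$ (i div b, j div e) * (B * D) $$ (i mod b, j mod e)"
    using A B C D ij by (auto simp: scalar_prod_def lessThan_atLeast0)
  also have "\<dots> = ((A * C) \<otimes>\<^sub>m (B * D)) $$ (i, j)"
    by (rule index_kron[OF AC BD i j, symmetric])
  finally show "((A \<otimes>\<^sub>m B) * (C \<otimes>\<^sub>m D)) $$ (i, j) = ((A * C) \<otimes>\<^sub>m (B * D)) $$ (i, j)" .
qed

lemma transpose_kron:
  "transpose_mat (A \<otimes>\<^sub>m B) = transpose_mat A \<otimes>\<^sub>m transpose_mat B"
  by (rule eq_matI)
    (auto simp: kron_def div_less_of_less_mult mod_less_of_less_mult)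

lemma kron_list_Nil [simp]: "kron_list [] = 1\<^sub>m 1"
  by (simp add: kron_list_def)

lemma kron_list_Cons [simp]: "kron_list (A # As) = A \<otimes>\<^sub>m kron_list As"
  by (simp add: kron_list_def)

text \<open>Mapping \<open>A\<close> over an index list lets the sizes depend on the same index. The
  base case works because \<open>1\<^sub>m 1\<close> has the size of an empty product.\<close>

lemma kron_list_carrier_mat:
  assumes "\<And>i. i \<in> set js \<Longrightarrow> A i \<in> carrier_mat (r i) (c i)"
  shows "kron_list (map A js) \<in> carrier_mat (prod_list (map r js)) (prod_list (map c js))"
  using assms by (induction js) (auto intro!: kron_carrier_mat)

text \<open>Iterates \<open>kron_mult\<close> along the list; the carrier facts for the tails supply
  its size conditions.\<close>

lemma kron_list_mult:
  fixes A B :: "'i \<Rightarrow> 'a :: comm_semiring_1 mat"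
  assumes "\<And>i. i \<in> set js \<Longrightarrow> A i \<in> carrier_mat (r i) (n i)"
    and "\<And>i. i \<in> set js \<Longrightarrow> B i \<in> carrier_mat (n i) (c i)"
  shows "kron_list (map A js) * kron_list (map B js) = kron_list (map (\<lambda>i. A i * B i) js)"
  using assms
proof (induction js)
  case (Cons k js)
  have "kron_list (map A js) \<in> carrier_mat (prod_list (map r js)) (prod_list (map n js))"
    "kron_list (map B js) \<in> carrier_mat (prod_list (map n js)) (prod_list (map c js))"
    using Cons.prems by (auto intro!: kron_list_carrier_mat)
  with Cons show ?case
    by (simp add: kron_mult[of "A k" "r k" "n k" "B k" "c k"])
qed simp

lemma transpose_kron_list:
  "transpose_mat (kron_list As) = kron_list (map transpose_mat As)"
  by (induction As) (simp_all add: transpose_kron)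

text \<open>Puts the three-piece list of \<open>kron_at\<close> into the form of a single map over
  \<open>[1..<Suc p]\<close>, so that \<open>kron_list_mult\<close> applies.\<close>

lemma kron_at_eq_kron_list:
  assumes "j \<in> {1..p}"
  shows "kron_at p d j M = kron_list (map (\<lambda>i. if i = j then M else 1\<^sub>m (d i)) [1..<Suc p])"
proof -
  \<comment> \<open>The simp rule \<open>upt_Suc\<close> would split \<open>p\<close> off the end of
    the list, whereas the split wanted is at \<open>j\<close>.\<close>
  have "[1..<Suc p] = [1..<j] @ j # [Suc j..<Suc p]"
    using assms upt_add_eq_append[of 1 j "Suc p - j"] by (simp add: upt_conv_Cons del: upt_Suc)
  moreover have "map (\<lambda>i. if i = j then M else 1\<^sub>m (d i)) [1..<j] = map (\<lambda>i. 1\<^sub>m (d i)) [1..<j]"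
    "map (\<lambda>i. if i = j then M else 1\<^sub>m (d i)) [Suc j..<Suc p] = map (\<lambda>i. 1\<^sub>m (d i)) [Suc j..<Suc p]"
    by (auto simp del: upt_Suc)
  ultimately show ?thesis
    by (simp only: kron_at_def map_append list.map append_Cons append_Nil simp_thms if_True)
qed

lemma total_dim_eq_prod_list: "total_dim p d = prod_list (map d [1..<Suc p])"
  unfolding total_dim_def
  by (subst prod.distinct_set_conv_list[symmetric])
    (simp_all add: atLeastLessThanSuc_atLeastAtMost del: upt_Suc)

lemma kron_at_carrier_mat:
  assumes "j \<in> {1..p}" "M \<in> carrier_mat (d j) (d j)"
  shows "kron_at p d j M \<in> carrier_mat (total_dim p d) (total_dim p d)"
  unfolding kron_at_eq_kron_list[OF assms(1)] total_dim_eq_prod_list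
  using assms(2) by (intro kron_list_carrier_mat) auto

text \<open>Two uses of \<open>kron_list_mult\<close> move the conjugation into each factor, where
  \<open>UV\<close> cancels all factors but the \<open>j\<close>-th. Later \<open>V i\<close> is the
  transpose of \<open>U i\<close>.\<close>

lemma kron_at_conjugate:
  fixes U V :: "nat \<Rightarrow> 'a :: comm_semiring_1 mat"
  assumes j: "j \<in> {1..p}"
    and U: "\<And>i. i \<in> {1..p} \<Longrightarrow> U i \<in> carrier_mat (d i) (d i)"
    and V: "\<And>i. i \<in> {1..p} \<Longrightarrow> V i \<in> carrier_mat (d i) (d i)"
    and UV: "\<And>i. i \<in> {1..p} \<Longrightarrow> U i * V i = 1\<^sub>m (d i)"
    and M: "M \<in> carrier_mat (d j) (d j)"
  shows "kron_list (map U [1..<Suc p]) * kron_at p d j M * kron_list (map V [1..<Suc p]) =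
    kron_at p d j (U j * M * V j)"
proof -
  let ?N = "\<lambda>i. if i = j then M else 1\<^sub>m (d i)"
  have U': "\<And>i. i \<in> set [1..<Suc p] \<Longrightarrow> U i \<in> carrier_mat (d i) (d i)"
    and V': "\<And>i. i \<in> set [1..<Suc p] \<Longrightarrow> V i \<in> carrier_mat (d i) (d i)"
    and N': "\<And>i. i \<in> set [1..<Suc p] \<Longrightarrow> ?N i \<in> carrier_mat (d i) (d i)"
    using U V M by auto
  have "kron_list (map U [1..<Suc p]) * kron_list (map ?N [1..<Suc p]) *
      kron_list (map V [1..<Suc p]) = kron_list (map (\<lambda>i. U i * ?N i * V i) [1..<Suc p])"
    by (simp only: kron_list_mult[of "[1..<Suc p]", OF U' N']
        kron_list_mult[of "[1..<Suc p]", OF mult_carrier_mat[OF U' N'] V'])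
  also have "map (\<lambda>i. U i * ?N i * V i) [1..<Suc p] =
      map (\<lambda>i. if i = j then U j * M * V j else 1\<^sub>m (d i)) [1..<Suc p]"
    using UV right_mult_one_mat[OF U'] by (intro map_cong refl) (auto simp del: upt_Suc)
  finally show ?thesis
    by (simp only: kron_at_eq_kron_list[OF j])
qed

text \<open>Distributivity on both sides, by induction on \<open>J\<close>; the empty sum is the
  \<open>n\<close> by \<open>n\<close> zero matrix, which conjugation preserves.\<close>

lemma finsum_mat_conjugate:
  fixes P R :: "'a :: comm_ring_1 mat"
  assumes P: "P \<in> carrier_mat n n" and R: "R \<in> carrier_mat n n"
    and "finite J" and "\<And>j. j \<in> J \<Longrightarrow> F j \<in> carrier_mat n n"
  shows "finsum (module_mat TYPE('a) n n) (\<lambda>j. P * F j * R) J =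
    P * finsum (module_mat TYPE('a) n n) F J * R"
proof -
  interpret abelian_group "module_mat TYPE('a) n n"
    by (rule abelian_group_mat)
  show ?thesis
    using assms(3,4)
  proof (induction J rule: finite_induct)
    case empty
    then show ?case
      using P R by (simp add: module_mat_simps)
  next
    case (insert k J)
    let ?S = "finsum (module_mat TYPE('a) n n) F J"
    have F: "F \<in> J \<rightarrow> carrier_mat n n" "F k \<in> carrier_mat n n"
      using insert.prems by auto
    then have S: "?S \<in> carrier_mat n n"
      using finsum_closed[of F J] by (simp add: module_mat_simps)
    have G: "(\<lambda>j. P * F j * R) \<in> J \<rightarrow> carrier_mat n n" "P * F k * R \<in> carrier_mat n n"
      using P R F by auto
    have "P * (F k + ?S) * R = P * F k * R + P * ?S * R"
      using P R F S by (simp add: mult_add_distrib_mat add_mult_distrib_mat[of _ n n _ _ n])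
    moreover have "finsum (module_mat TYPE('a) n n) F (insert k J) = F k + ?S"
      \<comment> \<open>Unfolding \<open>module_mat_simps\<close> turns the addition and carrier of
        the module into those of matrices.\<close>
      by (rule finsum_insert[unfolded module_mat_simps, OF insert.hyps F])
    moreover have "finsum (module_mat TYPE('a) n n) (\<lambda>j. P * F j * R) (insert k J) =
        P * F k * R + finsum (module_mat TYPE('a) n n) (\<lambda>j. P * F j * R) J"
      by (rule finsum_insert[unfolded module_mat_simps, OF insert.hyps G])
    ultimately show ?case
      using insert by simp
  qed
qed

text \<open>The scalars \<open>1 / t j\<close> commute with multiplication by \<open>P\<close> and
  \<open>R\<close>, which reduces the claim to the unweighted sum.\<close>

lemma weighted_sum_conjugate:
  assumes P: "P \<in> carrier_mat n n" and R: "R \<in> carrier_mat n n"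
    and M: "\<And>j. j \<in> {1..p} \<Longrightarrow> M j \<in> carrier_mat n n"
    and L: "\<And>j. j \<in> {1..p} \<Longrightarrow> L j = P * M j * R"
  shows "weighted_sum n p t L = P * weighted_sum n p t M * R"
proof -
  interpret abelian_group "module_mat TYPE(real) n n"
    by (rule abelian_group_mat)
  have "(1 / t j) \<cdot>\<^sub>m L j = P * ((1 / t j) \<cdot>\<^sub>m M j) * R" if "j \<in> {1..p}" for j
    using P R M[OF that] L[OF that]
    by (simp add: mult_smult_distrib mult_smult_assoc_mat[of _ n n _ n])
  then have "weighted_sum n p t L =
      finsum (module_mat TYPE(real) n n) (\<lambda>j. P * ((1 / t j) \<cdot>\<^sub>m M j) * R) {1..p}"
    unfolding weighted_sum_def using P R M
    by (intro finsum_cong') (auto simp: module_mat_simps)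
  also have "\<dots> = P * weighted_sum n p t M * R"
    unfolding weighted_sum_def using M by (intro finsum_mat_conjugate P R) auto
  finally show ?thesis .
qed

theorem theorem3p1:
  fixes p :: nat and d :: "nat \<Rightarrow> nat"
    and Qt \<Gamma>t :: "nat \<Rightarrow> real mat" and Q :: "real mat" and \<Gamma> :: "nat \<Rightarrow> real mat"
  assumes "p \<ge> 2"
    and "\<And>j. j \<in> {1..p} \<Longrightarrow> d j \<ge> 4"
    and "\<And>j. j \<in> {1..p} \<Longrightarrow> eigendecomposition (d j) (marginal_penalty (d j)) (Qt j) (\<Gamma>t j)"
    and "Q = kron_list (map Qt [1..<Suc p])"
    and "\<And>j. j \<in> {1..p} \<Longrightarrow> \<Gamma> j = kron_at p d j (\<Gamma>t j)"
  shows "\<forall>\<tau>2 :: nat \<Rightarrow> real. (\<forall>j \<in> {1..p}. \<tau>2 j > 0) \<longrightarrow>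
    roughness_penalty p d \<tau>2 = Q * weighted_sum (total_dim p d) p \<tau>2 \<Gamma> * transpose_mat Q"
proof (intro allI impI)
  fix \<tau>2 :: "nat \<Rightarrow> real"
  have Qt: "Qt j \<in> carrier_mat (d j) (d j)" "Qt j * transpose_mat (Qt j) = 1\<^sub>m (d j)"
    and \<Gamma>t: "\<Gamma>t j \<in> carrier_mat (d j) (d j)"
    and K: "marginal_penalty (d j) = Qt j * \<Gamma>t j * transpose_mat (Qt j)"
    if "j \<in> {1..p}" for j
    using assms(3)[OF that] by (auto simp: eigendecomposition_def orthonormal_mat_def)
  \<comment> \<open>Transposition acts factorwise and keeps the order of the factors, so the result
    can serve as the right-hand product in \<open>kron_at_conjugate\<close>.\<close>
  have Q_transpose: "transpose_mat Q = kron_list (map (\<lambda>i. transpose_mat (Qt i)) [1..<Suc p])"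
    by (simp add: assms(4) transpose_kron_list comp_def del: upt_Suc)
  have Q: "Q \<in> carrier_mat (total_dim p d) (total_dim p d)"
    unfolding assms(4) total_dim_eq_prod_list using Qt by (intro kron_list_carrier_mat) auto
  have "kron_at p d j (marginal_penalty (d j)) = Q * \<Gamma> j * transpose_mat Q"
    if j: "j \<in> {1..p}" for j
    \<comment> \<open>\<open>transpose_mat Q\<close> is rewritten first, because expanding
      \<open>Q\<close> would destroy the left-hand side of \<open>Q_transpose\<close>.\<close>
    unfolding assms(5)[OF j] Q_transpose unfolding assms(4) K[OF j]
    using Qt \<Gamma>t[OF j] by (intro kron_at_conjugate[OF j, symmetric]) auto
  then show "roughness_penalty p d \<tau>2 =
      Q * weighted_sum (total_dim p d) p \<tau>2 \<Gamma> * transpose_mat Q"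
    unfolding roughness_penalty_def using Q assms(5) \<Gamma>t
    by (intro weighted_sum_conjugate) (auto simp: kron_at_carrier_mat)
qed

end
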